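(* Let $k\ge 3$, let $n>2$, $t\ge 1$ with $n>kt$, and let $\mathtt{Base}$ be a binary consensus protocol for $n>kt$ processes (i.e. a protocol solving binary Byzantine consensus among $n$ processes of which at most $t$ are faulty). Let $\mathtt{CC2}=L_2\odot\mathtt{Base}$ be the composition of the layer $L_2$ with $\mathtt{Base}$. Then $\mathtt{CC2}$ is a binary consensus protocol (every run with at most $t$ faulty processes satisfies Decision, Agreement and Validity) in which: 1. In failure-free runs, decisions occur after 2 rounds (at time 2) and at most $2n(t+1)$ bits are communicated. 2. When failures occur, at most $2n(t+1)+n^2$ bits are sent, and 3 rounds elapse, before reverting to the base protocol. 3. In the common case (failure-free runs), $\mathtt{CC2}$ decides on the majority value $MAJ(v_0,\dots,v_{n-1})$.
   Context: **Model.** There is a set $\mathbb{P}=\{0,\dots,n-1\}$ of $n>2$ processes, every pair connected by a reliable two-way link; receivers know the identity of the sender. Time is discrete and global, starting at $0$; round $m+1$ takes place between times $m$ and $m+1$, and a message sent at time $m$ is received by time $m+1$. The local state of process $i$ at time $m$ consists of its initial value $v_i$, the time $m$, and the sequence of its actions so far, including messages sent and received. A protocol is a deterministic function from local states to messages sent and decisions; protocols know $n$ and $t$. In each run a process is either correct (follows the protocol) or faulty (Byzantine: behaves arbitrarily). At most $t$ processes are faulty in each run, where $1\le t<n$. A run is failure-free if no process is faulty in it. **Consensus.** Each process $i$ starts with $v_i\in V$; in binary consensus $V=\{0,1\}$. A consensus protocol is one all of whose runs (with at most $t$ faulty processes) satisfy: *Decision*: every correct process eventually decides; *Agreement*: all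 correct processes make the same decision; *Validity*: if all correct processes have the same initial value, then all correct processes decide on this value. **Majority.** $MAJ:\{0,1\}^n\to\{0,1\}$ equals $1$ if at least $n/2$ of the votes are $1$, and $0$ otherwise. **Layer $L_2$ composed with $\mathtt{Base}$.** The committee (Sanhedrin) is $\{0,1,\dots,2t\}$. - Time 0, every process $i$: for each $j\in\{0,\dots,2t\}$, if $j\bmod 2=v_i$ send nothing to $j$; else send $v_i$ to $j$. - Time 1, every $j\in\{0,\dots,2t\}$: for each $i$ set $\mathtt{values}_j[i]:=j\bmod 2$ if no message from $i$ was received, and $(j+1)\bmod 2$ otherwise. Set $rec_j:=MAJ(\mathtt{values}_j)$. For each process $i$: if $i\bmod 2=rec_j$ send nothing to $i$; else send $rec_j$ to $i$. - Time 2, every process $i$ (the recommendation of $j\in\{0,\dots,2t\}$ to $i$ is $i\bmod 2$ if $i$ received no round-2 message from $j$, and $(i+1)\bmod 2$ otherwise): if $i$ received the same recommendation $rec$ from all of $\{0,\dots,2t\}$, then set $est_i:=rec$, decide $est_i$ and send nothing. Else: if more than $t$ of $\{0,\dots,2t\}$ recommended a value $rec$, set $est_i:=rec$, otherwise set $est_i:=v_i$; and send a 'help' message to all. - Time 3 and beyond, every process $i$: if no 'help' message was received, halt. Else execute $\mathtt{Base}$ with initial value $est_i$ (time 3 acting as time 0 of $\mathtt{Base}$), letting $\mathsf{dec}$ be the value it decides; if $i$ did not decide at time 2, it decides $\mathsf{dec}$. **Conventions.** "To all" includes the sender itself: a process receives the messages it sends to itself, but these are local and cost no bits. Round-3 messages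 other than 'help' are ignored. Each message of the layer (a binary value or 'help') costs one bit. Bit counts refer to bits sent by correct processes. "Before reverting to the base protocol" means: in the rounds preceding the start of $\mathtt{Base}$; all communication by correct processes afterwards is that of $\mathtt{Base}$. *)

theory Defs
  imports Main
begin

section \<open>Synchronous message passing with Byzantine faults\<close>

text \<open>
  The processes are the numbers below \<open>n\<close>. An action is what a process does at one point in
  time: \<open>sent a j\<close> is the message sent to \<open>j\<close> (\<open>None\<close> if there is none), and \<open>decision a\<close> is the
  value decided on, if any.
\<close>

record ('v, 'm) action =
  sent :: "nat \<Rightarrow> 'm option"
  decision :: "'v option"

definition idle :: "('v, 'm) action" where
  "idle = \<lparr>sent = (\<lambda>_. None), decision = None\<rparr>"

text \<open>
  The history has one entry per elapsed round, hence its length is the current time. Entry \<open>k\<close>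
  consists of the action performed at time \<open>k\<close> and of the messages, indexed by sender, received in
  the round between times \<open>k\<close> and \<open>k + 1\<close>.
\<close>

record ('v, 'm) local_state =
  initial :: 'v
  history :: "(('v, 'm) action \<times> (nat \<Rightarrow> 'm option)) list"

definition time :: "('v, 'm) local_state \<Rightarrow> nat" where
  "time s = length (history s)"

text \<open>\<open>P i s\<close> is the action that process \<open>i\<close> performs in local state \<open>s\<close>.\<close>

type_synonym ('v, 'm) protocol = "nat \<Rightarrow> ('v, 'm) local_state \<Rightarrow> ('v, 'm) action"

text \<open>In the following, \<open>act m i\<close> is the action of process \<open>i\<close> at time \<open>m\<close>.\<close>

definition received ::
  "nat \<Rightarrow> (nat \<Rightarrow> nat \<Rightarrow> ('v, 'm) action) \<Rightarrow> nat \<Rightarrow> nat \<Rightarrow> nat \<Rightarrow> 'm option" where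
  "received n act m i = (\<lambda>j. if j < n then sent (act m j) i else None)"

definition state_at ::
  "nat \<Rightarrow> (nat \<Rightarrow> 'v) \<Rightarrow> (nat \<Rightarrow> nat \<Rightarrow> ('v, 'm) action) \<Rightarrow> nat \<Rightarrow> nat \<Rightarrow> ('v, 'm) local_state" where
  "state_at n v act i m =
     \<lparr>initial = v i, history = map (\<lambda>k. (act k i, received n act k i)) [0..<m]\<rparr>"

text \<open>\<open>F\<close> is the set of faulty processes of the run; their actions are unconstrained.\<close>

definition run ::
  "nat \<Rightarrow> nat \<Rightarrow> ('v, 'm) protocol \<Rightarrow> nat set \<Rightarrow> (nat \<Rightarrow> 'v) \<Rightarrow> (nat \<Rightarrow> nat \<Rightarrow> ('v, 'm) action) \<Rightarrow> bool"
  where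
  "run n t P F v act \<longleftrightarrow>
     F \<subseteq> {..<n} \<and> card F \<le> t \<and>
     (\<forall>i\<in>{..<n} - F. \<forall>m. act m i = P i (state_at n v act i m))"

section \<open>Consensus\<close>

text \<open>
  A decide action may be repeated, but agreement (with \<open>i = j\<close>) makes the value decided on by a
  correct process unique. The set of possible values is the type \<open>'v\<close>.
\<close>

definition decision_property :: "nat \<Rightarrow> nat set \<Rightarrow> (nat \<Rightarrow> nat \<Rightarrow> ('v, 'm) action) \<Rightarrow> bool" where
  "decision_property n F act \<longleftrightarrow>
     (\<forall>i\<in>{..<n} - F. \<exists>m d. decision (act m i) = Some d)"

definition agreement :: "nat \<Rightarrow> nat set \<Rightarrow> (nat \<Rightarrow> nat \<Rightarrow> ('v, 'm) action) \<Rightarrow> bool" where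
  "agreement n F act \<longleftrightarrow>
     (\<forall>i\<in>{..<n} - F. \<forall>j\<in>{..<n} - F. \<forall>m m' d d'.
        decision (act m i) = Some d \<longrightarrow> decision (act m' j) = Some d' \<longrightarrow> d = d')"

definition validity ::
  "nat \<Rightarrow> nat set \<Rightarrow> (nat \<Rightarrow> 'v) \<Rightarrow> (nat \<Rightarrow> nat \<Rightarrow> ('v, 'm) action) \<Rightarrow> bool" where
  "validity n F v act \<longleftrightarrow>
     (\<forall>b. (\<forall>i\<in>{..<n} - F. v i = b) \<longrightarrow>
          (\<forall>i\<in>{..<n} - F. \<exists>m. decision (act m i) = Some b))"

definition consensus_protocol :: "nat \<Rightarrow> nat \<Rightarrow> ('v, 'm) protocol \<Rightarrow> bool" where
  "consensus_protocol n t P \<longleftrightarrow>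
     (\<forall>F v act. run n t P F v act \<longrightarrow>
        decision_property n F act \<and> agreement n F act \<and> validity n F v act)"

section \<open>The layer composed with a base protocol\<close>

text \<open>
  Binary values are Booleans, with \<open>True\<close> for 1 and \<open>False\<close> for 0; the value \<open>j mod 2\<close> is thus
  \<open>odd j\<close>.
\<close>

definition MAJ :: "nat \<Rightarrow> (nat \<Rightarrow> bool) \<Rightarrow> bool" where
  "MAJ n f \<longleftrightarrow> n \<le> 2 * card {i. i < n \<and> f i}"

datatype 'm cc_msg = Val bool | Help | BaseMsg 'm

definition committee :: "nat \<Rightarrow> nat set" where
  "committee t = {0..2 * t}"

definition received_in :: "('v, 'm) local_state \<Rightarrow> nat \<Rightarrow> nat \<Rightarrow> 'm option" where
  "received_in s k = snd (history s ! k)"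

definition committee_value :: "nat \<Rightarrow> (bool, 'm cc_msg) local_state \<Rightarrow> nat \<Rightarrow> bool" where
  "committee_value j s i = (if received_in s 0 i = None then odd j else odd (j + 1))"

definition rec_value :: "nat \<Rightarrow> nat \<Rightarrow> (bool, 'm cc_msg) local_state \<Rightarrow> bool" where
  "rec_value n j s = MAJ n (committee_value j s)"

text \<open>The recommendation of \<open>j\<close> as perceived by \<open>i\<close>.\<close>

definition recommendation :: "nat \<Rightarrow> (bool, 'm cc_msg) local_state \<Rightarrow> nat \<Rightarrow> bool" where
  "recommendation i s j = (if received_in s 1 j = None then odd i else odd (i + 1))"

definition unanimous :: "nat \<Rightarrow> nat \<Rightarrow> (bool, 'm cc_msg) local_state \<Rightarrow> bool \<Rightarrow> bool" where
  "unanimous t i s b \<longleftrightarrow> (\<forall>j\<in>committee t. recommendation i s j = b)"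

definition supported :: "nat \<Rightarrow> nat \<Rightarrow> (bool, 'm cc_msg) local_state \<Rightarrow> bool \<Rightarrow> bool" where
  "supported t i s b \<longleftrightarrow> t < card {j \<in> committee t. recommendation i s j = b}"

text \<open>
  The descriptions below are proper, as at most one value can be unanimous or be recommended by
  more than \<open>t\<close> of the \<open>2 * t + 1\<close> committee members.
\<close>

definition estimate :: "nat \<Rightarrow> nat \<Rightarrow> (bool, 'm cc_msg) local_state \<Rightarrow> bool" where
  "estimate t i s =
     (if \<exists>b. unanimous t i s b then THE b. unanimous t i s b
      else if \<exists>b. supported t i s b then THE b. supported t i s b
      else initial s)"

text \<open>
  The local state that process \<open>i\<close> reaches when it executes \<open>P\<close> with initial value \<open>e\<close> and
  receives the messages \<open>rs\<close>, one entry per round. A process that decided in the layer does not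
  perform the decide actions of the base protocol, but these are nevertheless part of the base
  protocol's local state; therefore the base actions are recomputed rather than read off the
  history of the composed protocol.
\<close>

definition execute ::
  "('v, 'm) protocol \<Rightarrow> nat \<Rightarrow> 'v \<Rightarrow> (nat \<Rightarrow> 'm option) list \<Rightarrow> ('v, 'm) local_state" where
  "execute P i e rs =
     foldl (\<lambda>s r. s\<lparr>history := history s @ [(P i s, r)]\<rparr>) \<lparr>initial = e, history = []\<rparr> rs"

text \<open>
  What the base protocol sees of the received messages: anything that is not one of its own
  messages (and hence comes from a faulty process) counts as no message.
\<close>

definition base_view :: "(nat \<Rightarrow> 'm cc_msg option) \<Rightarrow> nat \<Rightarrow> 'm option" where
  "base_view r j = (case r j of Some (BaseMsg x) \<Rightarrow> Some x | _ \<Rightarrow> None)"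

definition CC2 :: "nat \<Rightarrow> nat \<Rightarrow> (bool, 'm) protocol \<Rightarrow> (bool, 'm cc_msg) protocol" where
  "CC2 n t Base i s =
     (if time s = 0 then
        \<lparr>sent = (\<lambda>j. if j \<in> committee t \<and> odd j \<noteq> initial s then Some (Val (initial s)) else None),
         decision = None\<rparr>
      else if time s = 1 then
        (if i \<in> committee t then
           \<lparr>sent = (\<lambda>j. if j < n \<and> odd j \<noteq> rec_value n i s
                        then Some (Val (rec_value n i s)) else None),
            decision = None\<rparr>
         else idle)
      else if time s = 2 then
        (if \<exists>b. unanimous t i s b then
           \<lparr>sent = (\<lambda>_. None), decision = Some (estimate t i s)\<rparr>
         else
           \<lparr>sent = (\<lambda>j. if j < n then Some Help else None), decision = None\<rparr>)
      else
        (if \<exists>j<n. received_in s 2 j = Some Help then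
           (let b = Base i (execute Base i (estimate t i s)
                              (map (\<lambda>(_, r). base_view r) (drop 3 (history s))))
            in \<lparr>sent = (\<lambda>j. map_option BaseMsg (sent b j)),
                decision = (if decision (fst (history s ! 2)) = None then decision b else None)\<rparr>)
         else idle))"

section \<open>Bits, and the start of the base protocol\<close>

text \<open>The cost \<open>c\<close> of the messages of the base protocol is left open.\<close>

fun msg_bits :: "('m \<Rightarrow> nat) \<Rightarrow> 'm cc_msg option \<Rightarrow> nat" where
  "msg_bits c None = 0"
| "msg_bits c (Some (Val _)) = 1"
| "msg_bits c (Some Help) = 1"
| "msg_bits c (Some (BaseMsg x)) = c x"

text \<open>
  The bits sent by correct processes before time \<open>T\<close>, that is, in the first \<open>T\<close> rounds. Messages
  of a process to itself are free.
\<close>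

definition bits_before ::
  "('m \<Rightarrow> nat) \<Rightarrow> nat \<Rightarrow> nat set \<Rightarrow> (nat \<Rightarrow> nat \<Rightarrow> (bool, 'm cc_msg) action) \<Rightarrow> nat \<Rightarrow> nat" where
  "bits_before c n F act T =
     (\<Sum>m<T. \<Sum>i\<in>{..<n} - F. \<Sum>j\<in>{..<n} - {i}. msg_bits c (sent (act m i) j))"

text \<open>
  \<open>i\<close> sends no message of the base protocol before time \<open>T\<close>, and from then on its messages are
  those of the base protocol with initial value \<open>e\<close> and \<open>T\<close> as time 0.
\<close>

definition reverts_to_base_at ::
  "nat \<Rightarrow> (bool, 'm) protocol \<Rightarrow> (nat \<Rightarrow> nat \<Rightarrow> (bool, 'm cc_msg) action) \<Rightarrow> nat \<Rightarrow> bool \<Rightarrow> nat \<Rightarrow> bool"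
  where
  "reverts_to_base_at n Base act i e T \<longleftrightarrow>
     (\<forall>m<T. \<forall>j x. sent (act m i) j \<noteq> Some (BaseMsg x)) \<and>
     (\<forall>m j. sent (act (T + m) i) j =
        map_option BaseMsg
          (sent (Base i (execute Base i e
                   (map (\<lambda>k. base_view (received n act (T + k) i)) [0..<m]))) j))"

end

theory Submission
  imports Defs
begin

text \<open>
  At least \<open>t + 1\<close> of the \<open>2 * t + 1\<close> committee members are correct, and each of them is perceived
  by all correct processes as recommending the same value. So if some correct process sees a
  unanimous \<open>d\<close>, every correct process has estimate \<open>d\<close>. Either all correct processes decide at
  time 2, or some correct process calls for help and then all correct processes take part in the
  base protocol, whose validity takes care of decisions already made. Since silence carries a
  value, only about half of the messages of the first two rounds are actually sent.
\<close>

section \<open>Counting by parity and majorities\<close>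

text \<open>Counting starts at 0, so the even numbers, selected by \<open>b = True\<close>, form the
  larger half when \<open>N\<close> is odd.\<close>

lemma card_parity_less:
  "card {j. j < N \<and> odd j \<noteq> b} = (if b then (N + 1) div 2 else N div 2)"
proof (induction N)
  case (Suc N)
  have "{j. j < Suc N \<and> odd j \<noteq> b} =
      (if odd N \<noteq> b then insert N {j. j < N \<and> odd j \<noteq> b} else {j. j < N \<and> odd j \<noteq> b})"
    by (auto simp: less_Suc_eq)
  then show ?case
    using Suc by (cases b; cases "odd N"; simp; presburger)
qed simp

lemma card_parity_less_le: "card {j. j < N \<and> odd j \<noteq> b} \<le> (N + 1) div 2"
  unfolding card_parity_less by (simp add: div_le_mono)

text \<open>Serves to bound the bits one process sends in a round by its number of recipients; the
  free message to itself is counted generously on the right.\<close>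

lemma sum_le_card_Collect_less:
  fixes f :: "nat \<Rightarrow> nat"
  assumes "\<And>j. j < n \<Longrightarrow> f j \<le> of_bool (Q j)"
  shows "(\<Sum>j\<in>{..<n} - {i}. f j) \<le> card {j. j < n \<and> Q j}"
proof -
  have "(\<Sum>j\<in>{..<n} - {i}. f j) \<le> (\<Sum>j<n. f j)"
    by (rule sum_mono2) auto
  also have "\<dots> \<le> (\<Sum>j<n. of_bool (Q j))"
    by (rule sum_mono) (use assms in simp)
  also have "\<dots> = card ({..<n} \<inter> {j. Q j})"
    by (simp add: of_bool_def sum.If_cases)
  also have "{..<n} \<inter> {j. Q j} = {j. j < n \<and> Q j}"
    by auto
  finally show ?thesis .
qed

lemma MAJ_cong: "(\<And>i. i < n \<Longrightarrow> f i = g i) \<Longrightarrow> MAJ n f = MAJ n g"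
  unfolding MAJ_def by (metis (mono_tags, lifting) Collect_cong)

text \<open>The indices outside \<open>F\<close> are a strict majority, so neither the values on
  \<open>F\<close> nor the breaking of ties towards \<open>True\<close> can matter.\<close>

lemma MAJ_eqI:
  assumes F: "F \<subseteq> {..<n}" "2 * card F < n"
    and b: "\<And>i. i < n \<Longrightarrow> i \<notin> F \<Longrightarrow> f i = b"
  shows "MAJ n f = b"
proof (cases b)
  case True
  have "card ({..<n} - F) = n - card F"
    using F by (simp add: card_Diff_subset finite_subset)
  moreover have "card ({..<n} - F) \<le> card {i. i < n \<and> f i}"
    by (rule card_mono) (use b True in auto)
  ultimately show ?thesis
    using F True unfolding MAJ_def by linarith
next
  case False
  have "card {i. i < n \<and> f i} \<le> card F"
    by (rule card_mono) (use F b False in \<open>auto intro: finite_subset\<close>)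
  then show ?thesis
    using F False unfolding MAJ_def by linarith
qed

section \<open>Unanimous and supported recommendations\<close>

lemma finite_committee [simp]: "finite (committee t)"
  by (simp add: committee_def)

lemma card_committee [simp]: "card (committee t) = 2 * t + 1"
  by (simp add: committee_def)

lemma unanimous_unique: "unanimous t i s b \<Longrightarrow> unanimous t i s b' \<Longrightarrow> b = b'"
  by (force simp: unanimous_def committee_def)

text \<open>Two disjoint sets of more than \<open>t\<close> supporters do not fit into
  \<open>2 * t + 1\<close> members.\<close>

lemma supported_unique:
  assumes "supported t i s b" "supported t i s b'"
  shows "b = b'"
proof (rule ccontr)
  assume "b \<noteq> b'"
  let ?A = "\<lambda>b. {j \<in> committee t. recommendation i s j = b}"
  have "card (?A b) + card (?A b') = card (?A b \<union> ?A b')"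
    using \<open>b \<noteq> b'\<close> by (subst card_Un_disjoint) auto
  also have "\<dots> \<le> card (committee t)"
    by (rule card_mono) auto
  finally show False
    using assms by (simp add: supported_def)
qed

lemma estimate_unanimous:
  assumes "unanimous t i s b"
  shows "estimate t i s = b"
proof -
  have "(THE b. unanimous t i s b) = b"
    using assms by (rule the_equality) (rule unanimous_unique[OF _ assms])
  then show ?thesis
    using assms by (auto simp: estimate_def)
qed

lemma estimate_supported:
  assumes "supported t i s b" "\<And>b'. unanimous t i s b' \<Longrightarrow> b' = b"
  shows "estimate t i s = b"
proof (cases "\<exists>b. unanimous t i s b")
  case True
  then show ?thesis
    using assms(2) estimate_unanimous by blast
next
  case False
  have "(THE b. supported t i s b) = b"
    using assms(1) by (rule the_equality) (rule supported_unique[OF _ assms(1)])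
  then show ?thesis
    using False assms(1) by (auto simp: estimate_def)
qed

text \<open>\<open>CC2\<close> recomputes the estimate at every time from 3 on; this makes all these
  values equal to the one of time 2.\<close>

lemma estimate_cong:
  assumes "received_in s 1 = received_in s' 1" "initial s = initial s'"
  shows "estimate t i s = estimate t i s'"
  unfolding estimate_def unanimous_def supported_def recommendation_def assms ..

section \<open>Reading local states\<close>

lemma initial_state_at [simp]: "initial (state_at n v act i m) = v i"
  by (simp add: state_at_def)

lemma time_state_at [simp]: "time (state_at n v act i m) = m"
  by (simp add: state_at_def time_def)

lemma received_in_state_at:
  "k < m \<Longrightarrow> received_in (state_at n v act i m) k = received n act k i"
  by (simp add: state_at_def received_in_def)

lemma action_in_state_at:
  "k < m \<Longrightarrow> fst (history (state_at n v act i m) ! k) = act k i"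
  by (simp add: state_at_def)

lemma received_less: "j < n \<Longrightarrow> received n act m i j = sent (act m j) i"
  by (simp add: received_def)

lemma execute_snoc:
  "execute P i e (rs @ [r]) =
     (execute P i e rs)\<lparr>history := history (execute P i e rs) @ [(P i (execute P i e rs), r)]\<rparr>"
  by (simp add: execute_def)

section \<open>Actions in a run of the composed protocol\<close>

text \<open>The bound makes every committee member a process and leaves a strict majority of the
  processes correct.\<close>

locale cc2_run =
  fixes n t :: nat and Base :: "(bool, 'm) protocol" and F :: "nat set"
    and v :: "nat \<Rightarrow> bool" and act :: "nat \<Rightarrow> nat \<Rightarrow> (bool, 'm cc_msg) action"
  assumes committee_bound: "2 * t < n"
    and run: "run n t (CC2 n t Base) F v act"
begin

abbreviation st :: "nat \<Rightarrow> nat \<Rightarrow> (bool, 'm cc_msg) local_state" where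
  "st i m \<equiv> state_at n v act i m"

definition correct :: "nat \<Rightarrow> bool" where
  "correct i \<longleftrightarrow> i < n \<and> i \<notin> F"

definition recommended :: "nat \<Rightarrow> bool" where
  "recommended j = rec_value n j (st j 1)"

definition est :: "nat \<Rightarrow> bool" where
  "est i = estimate t i (st i 2)"

definition unanimity :: "nat \<Rightarrow> bool" where
  "unanimity i \<longleftrightarrow> (\<exists>b. unanimous t i (st i 2) b)"

definition helped :: "nat \<Rightarrow> bool" where
  "helped i \<longleftrightarrow> (\<exists>j<n. received n act 2 i j = Some Help)"

text \<open>Makes sense for a process that decided at time 2 as well: if helped, it runs
  \<open>Base\<close> too and only its later decisions are suppressed.\<close>

definition base_state :: "nat \<Rightarrow> nat \<Rightarrow> (bool, 'm) local_state" where
  "base_state i m =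
     execute Base i (est i) (map (\<lambda>k. base_view (received n act (3 + k) i)) [0..<m])"

lemma F_subset: "F \<subseteq> {..<n}" and F_card: "card F \<le> t"
  using run by (auto simp: run_def)

lemma correct_iff: "i \<in> {..<n} - F \<longleftrightarrow> correct i"
  by (auto simp: correct_def)

lemma act_correct: "correct i \<Longrightarrow> act m i = CC2 n t Base i (st i m)"
  using run by (auto simp: run_def correct_def)

lemma act_0:
  "correct i \<Longrightarrow> act 0 i =
    \<lparr>sent = (\<lambda>j. if j \<in> committee t \<and> odd j \<noteq> v i then Some (Val (v i)) else None), decision = None\<rparr>"
  by (simp add: act_correct CC2_def cong: if_cong)

lemma act_1:
  "correct i \<Longrightarrow> act 1 i =
    (if i \<in> committee t
     then \<lparr>sent = (\<lambda>j. if j < n \<and> odd j \<noteq> recommended i then Some (Val (recommended i)) else None),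
           decision = None\<rparr>
     else idle)"
  by (simp add: act_correct CC2_def recommended_def cong: if_cong)

lemma act_2:
  "correct i \<Longrightarrow> act 2 i =
    (if unanimity i then \<lparr>sent = (\<lambda>_. None), decision = Some (est i)\<rparr>
     else \<lparr>sent = (\<lambda>j. if j < n then Some Help else None), decision = None\<rparr>)"
  by (simp add: act_correct CC2_def unanimity_def est_def)

text \<open>The protocol tests the decision recorded in the history at time 2; for a correct process
  this is the same as testing unanimity.\<close>

lemma act_3:
  assumes "correct i"
  shows "act (3 + m) i =
    (if helped i then
       \<lparr>sent = (\<lambda>j. map_option BaseMsg (sent (Base i (base_state i m)) j)),
        decision = (if unanimity i then None else decision (Base i (base_state i m)))\<rparr>
     else idle)"
proof -
  have "estimate t i (st i (3 + m)) = est i"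
    unfolding est_def by (rule estimate_cong) (simp_all add: received_in_state_at)
  moreover have "map (\<lambda>(_, r). base_view r) (drop 3 (history (st i (3 + m)))) =
      map (\<lambda>k. base_view (received n act (3 + k) i)) [0..<m]"
    by (rule nth_equalityI) (simp_all add: state_at_def)
  moreover have "fst (history (st i (3 + m)) ! 2) = act 2 i"
    by (rule action_in_state_at) simp
  moreover have "received_in (st i (3 + m)) 2 = received n act 2 i"
    by (rule received_in_state_at) simp
  moreover have "decision (act 2 i) = None \<longleftrightarrow> \<not> unanimity i"
    using assms by (simp add: act_2)
  ultimately show ?thesis
    by (simp only: act_correct[OF assms, of "3 + m"] CC2_def time_state_at helped_def
        base_state_def Let_def) auto
qed

section \<open>Recommendations and estimates\<close>

text \<open>Sender and recipient share the convention that silence stands for the parity of the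
  recipient, so decoding inverts encoding.\<close>

lemma recommendation_correct:
  assumes "j \<in> committee t - F" "i < n"
  shows "recommendation i (st i 2) j = recommended j"
proof -
  have j: "correct j" "j < n" "j \<in> committee t"
    using assms committee_bound by (auto simp: correct_def committee_def)
  show ?thesis
    using j assms(2) act_1[OF j(1)]
    by (simp add: recommendation_def received_in_state_at received_less)
qed

lemma committee_value_correct:
  assumes "j \<in> committee t" "correct i"
  shows "committee_value j (st j 1) i = v i"
  using assms act_0[OF assms(2)]
  by (simp add: committee_value_def received_in_state_at received_less correct_def)

lemma card_correct_committee: "t < card (committee t - F)"
proof -
  have "card (committee t) - card F \<le> card (committee t - F)"
    by (rule diff_card_le_card_Diff) (use F_subset finite_subset in blast)
  then show ?thesis
    using F_card by simp
qed

text \<open>Unanimity at one process includes the correct members, whose recommendations look the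
  same to everyone.\<close>

lemma unanimous_recommended:
  assumes "i < n" "unanimous t i (st i 2) b" "j \<in> committee t - F"
  shows "recommended j = b"
  using assms recommendation_correct[of j i] by (simp add: unanimous_def)

text \<open>The correct members alone exceed \<open>t\<close>, so they make \<open>b\<close>
  supported whatever the faulty ones say.\<close>

lemma est_eqI:
  assumes "i < n" and b: "\<And>j. j \<in> committee t - F \<Longrightarrow> recommended j = b"
  shows "est i = b"
  unfolding est_def
proof (rule estimate_supported)
  have "card (committee t - F) \<le> card {j \<in> committee t. recommendation i (st i 2) j = b}"
    by (rule card_mono) (use assms recommendation_correct in auto)
  then show "supported t i (st i 2) b"
    using card_correct_committee by (simp add: supported_def)
  fix b' assume "unanimous t i (st i 2) b'"
  \<comment> \<open>A single correct member suffices to force any unanimous value to be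
    \<open>b\<close>.\<close>
  moreover obtain j where "j \<in> committee t - F"
    using card_correct_committee by (metis card.empty equals0I not_less_zero)
  ultimately show "b' = b"
    using assms unanimous_recommended by metis
qed

text \<open>The key to agreement between processes deciding at time 2 and those relying on
  \<open>Base\<close>: the unanimous value is what all correct members recommend, hence the estimate
  everywhere.\<close>

lemma est_eq_of_unanimity:
  assumes "correct i" "unanimity i" "correct i'"
  shows "est i' = est i"
proof -
  obtain b where b: "unanimous t i (st i 2) b"
    using assms(2) by (auto simp: unanimity_def)
  have "est i = b" "est i' = b"
    using unanimous_recommended[OF _ b] assms by (auto intro!: est_eqI simp: correct_def)
  then show ?thesis
    by simp
qed

text \<open>Every correct member records \<open>b\<close> for all correct processes, which outvote
  the faulty ones, and so recommends \<open>b\<close>.\<close>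

lemma est_valid:
  assumes "\<And>i. correct i \<Longrightarrow> v i = b" "correct i"
  shows "est i = b"
proof (rule est_eqI)
  fix j assume "j \<in> committee t - F"
  then have "committee_value j (st j 1) i = b" if "i < n" "i \<notin> F" for i
    using that assms(1) committee_value_correct[of j i] by (simp add: correct_def)
  then show "recommended j = b"
    unfolding recommended_def rec_value_def
    using F_subset F_card committee_bound by (intro MAJ_eqI[of F]) auto
qed (use assms in \<open>simp add: correct_def\<close>)

lemma helped_if_not_unanimity:
  assumes "correct i" "\<not> unanimity i" "correct i'"
  shows "helped i'"
  unfolding helped_def
  using assms act_2[OF assms(1)]
  by (intro exI[of _ i]) (simp add: received_less correct_def)

section \<open>Times of decisions and of base messages\<close>

lemma decision_early: "correct i \<Longrightarrow> m < 2 \<Longrightarrow> decision (act m i) = None"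
  using act_0[of i] act_1[of i] by (auto simp: less_2_cases_iff idle_def)

lemma decision_cases:
  assumes "correct i" "decision (act m i) = Some d"
  obtains "m = 2" "unanimity i" "d = est i"
  | m' where "m = 3 + m'" "\<not> unanimity i" "decision (Base i (base_state i m')) = Some d"
proof -
  consider "m < 2" | "m = 2" | m' where "m = 3 + m'"
    by (metis Suc_leI le_Suc_ex linorder_neqE_nat numeral_3_eq_3 numeral_2_eq_2)
  then show thesis
  proof cases
    case 1
    then show thesis using assms decision_early by simp
  next
    case 2
    then show thesis
      using assms act_2[of i] that(1) by (simp split: if_splits)
  next
    case (3 m')
    then show thesis
      using assms act_3[of i m'] that(2) by (simp add: idle_def split: if_splits)
  qed
qed

lemma sent_base_msg:
  assumes "correct i" "m < 3"
  shows "sent (act m i) j \<noteq> Some (BaseMsg x)"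
proof -
  have "m = 0 \<or> m = 1 \<or> m = 2"
    using assms(2) by linarith
  then show ?thesis
    using act_0[OF assms(1)] act_1[OF assms(1)] act_2[OF assms(1)]
    by (elim disjE) (simp_all add: idle_def)
qed

lemma reverts_to_base:
  assumes "correct i" "helped i"
  shows "reverts_to_base_at n Base act i (est i) 3"
  using assms act_3[OF assms(1)] sent_base_msg[OF assms(1)]
  by (simp add: reverts_to_base_at_def base_state_def)

section \<open>The simulated run of the base protocol\<close>

text \<open>
  Faulty processes act in the simulated run as their messages are filtered by \<open>base_view\<close>, here
  applied to a single message by way of a constant family.
\<close>

definition base_act :: "nat \<Rightarrow> nat \<Rightarrow> (bool, 'm) action" where
  "base_act m i =
     (if correct i then Base i (base_state i m)
      else \<lparr>sent = (\<lambda>j. base_view (\<lambda>_. sent (act (3 + m) i) j) 0), decision = None\<rparr>)"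

text \<open>If all correct processes are helped, each sends precisely its base messages wrapped in
  \<open>BaseMsg\<close>, and \<open>base_view\<close> removes the wrapper.\<close>

lemma received_base_act:
  assumes "\<And>i. correct i \<Longrightarrow> helped i"
  shows "received n base_act m i = base_view (received n act (3 + m) i)"
proof
  fix j
  show "received n base_act m i j = base_view (received n act (3 + m) i) j"
    using act_3[of j m] assms
    by (cases "correct j"; cases "sent (Base j (base_state j m)) i")
       (simp_all add: received_def base_act_def base_view_def)
qed

lemma base_state_eq_state_at:
  assumes "\<And>i. correct i \<Longrightarrow> helped i" "correct i"
  shows "base_state i m = state_at n est base_act i m"
proof (induction m)
  case 0
  then show ?case
    by (simp add: base_state_def execute_def state_at_def)
next
  case (Suc m)
  have base_act_m: "base_act m i = Base i (base_state i m)"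
    using assms(2) by (simp add: base_act_def)
  have "base_state i (Suc m) = (base_state i m)\<lparr>history := history (base_state i m) @
      [(Base i (base_state i m), base_view (received n act (3 + m) i))]\<rparr>"
    by (simp add: base_state_def execute_snoc)
  also have "\<dots> = state_at n est base_act i (Suc m)"
    using Suc received_base_act[OF assms(1)] base_act_m by (simp add: state_at_def)
  finally show ?case .
qed

text \<open>Allows the consensus properties of \<open>Base\<close> to be applied, with the estimates
  as initial values.\<close>

lemma run_base:
  assumes "\<And>i. correct i \<Longrightarrow> helped i"
  shows "run n t Base F est base_act"
  using F_subset F_card base_state_eq_state_at[OF assms]
  by (auto simp: run_def base_act_def correct_def)

section \<open>Decision, agreement and validity\<close>

lemma consensus:
  assumes base: "consensus_protocol n t Base"
  shows "decision_property n F act \<and> agreement n F act \<and> validity n F v act"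
\<comment> \<open>If all correct processes are unanimous, faulty ones may still send help to only
  some of them. \<open>base_act\<close> need not be a run of \<open>Base\<close> then, but all
  decisions fall at time 2 anyway.\<close>
proof (cases "\<forall>i. correct i \<longrightarrow> unanimity i")
  case True
  have dec: "decision (act 2 i) = Some (est i)" if "correct i" for i
    using True that by (simp add: act_2)
  have "m = 2 \<and> d = est i" if "correct i" "decision (act m i) = Some d" for i m d
    using that by (rule decision_cases) (use that True in auto)
  then have "agreement n F act"
    using True est_eq_of_unanimity unfolding agreement_def correct_iff Ball_def by metis
  moreover have "decision_property n F act"
    using dec unfolding decision_property_def correct_iff Ball_def by blast
  moreover have "validity n F v act"
    using dec est_valid unfolding validity_def correct_iff Ball_def by blast
  ultimately show ?thesis
    by simp
next
  case False
  then have "helped i" if "correct i" for i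
    using helped_if_not_unanimity that by blast
  note helped = this
  have D: "decision_property n F base_act" and A: "agreement n F base_act"
    and V: "validity n F est base_act"
    using base run_base[OF helped] by (auto simp: consensus_protocol_def)
  have dec: "decision (act 2 i) = Some (est i)" if "correct i" "unanimity i" for i
    using that by (simp add: act_2)
  have dec_base: "decision (act (3 + m) i) = decision (base_act m i)"
    if "correct i" "\<not> unanimity i" for i m
    using that helped act_3[of i m] by (simp add: base_act_def)
  \<comment> \<open>Validity yields some decision of \<open>i\<close> on \<open>b\<close>; agreement
    of \<open>i\<close> with itself extends this to all its decisions.\<close>
  have base_est: "d = b"
    if "\<And>i. correct i \<Longrightarrow> est i = b" "correct i" "decision (base_act m i) = Some d" for b i m d
    using A V that unfolding agreement_def validity_def correct_iff Ball_def by metis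
  have base_ex: "\<exists>m d. decision (base_act m i) = Some d" if "correct i" for i
    using D that unfolding decision_property_def correct_iff Ball_def by blast
  have dcases: "(unanimity i \<and> d = est i) \<or> (\<not> unanimity i \<and> (\<exists>m'. decision (base_act m' i) = Some d))"
    if "correct i" "decision (act m i) = Some d" for i m d
    using that by (rule decision_cases) (use that in \<open>auto simp: base_act_def\<close>)
  have "d = d'" if "correct i" "correct j"
    "decision (act m i) = Some d" "decision (act m' j) = Some d'" for i j m m' d d'
  \<comment> \<open>A unanimous \<open>l\<close> makes all estimates equal, so \<open>Base\<close>
    cannot contradict an early decision. Without such an \<open>l\<close>, all decisions come from
    \<open>Base\<close>, whose agreement applies.\<close>
  proof (cases "\<exists>l. correct l \<and> unanimity l")
    case True
    then obtain l where "\<And>i. correct i \<Longrightarrow> est i = est l"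
      using est_eq_of_unanimity by blast
    then have "d = est l" "d' = est l"
      using that dcases base_est by metis+
    then show ?thesis
      by simp
  next
    case False
    then show ?thesis
      using that dcases A unfolding agreement_def correct_iff Ball_def by metis
  qed
  then have "agreement n F act"
    unfolding agreement_def correct_iff Ball_def by blast
  moreover have "decision_property n F act"
    using dec dec_base base_ex unfolding decision_property_def correct_iff Ball_def by metis
  moreover have "\<exists>m. decision (act m i) = Some b"
    if b: "\<And>i. correct i \<Longrightarrow> v i = b" and i: "correct i" for b i
  proof -
    have "est i = b" if "correct i" for i
      using est_valid b that by blast
    note est_b = this
    show ?thesis
    proof (cases "unanimity i")
      case True
      then show ?thesis
        using dec est_b i by auto
    next
      case False
      obtain m d where md: "decision (base_act m i) = Some d"
        using base_ex i by blast
      then have "d = b"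
        using base_est[OF est_b i] by blast
      then show ?thesis
        using md dec_base[OF i False, of m] by auto
    qed
  qed
  then have "validity n F v act"
    unfolding validity_def correct_iff Ball_def by blast
  ultimately show ?thesis
    by simp
qed

section \<open>Counting bits round by round\<close>

definition round_bits :: "('m \<Rightarrow> nat) \<Rightarrow> nat \<Rightarrow> nat" where
  "round_bits c m = (\<Sum>i\<in>{..<n} - F. \<Sum>j\<in>{..<n} - {i}. msg_bits c (sent (act m i) j))"

lemma bits_before_eq: "bits_before c n F act T = (\<Sum>m<T. round_bits c m)"
  by (simp add: bits_before_def round_bits_def)

lemma card_correct_le: "card ({..<n} - F) \<le> n"
  using card_mono[of "{..<n}" "{..<n} - F"] by simp

text \<open>Each process writes only to members of one parity, and at most \<open>t + 1\<close> of
  the numbers up to \<open>2 * t\<close> have it.\<close>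

lemma round_bits_0: "round_bits c 0 \<le> n * (t + 1)"
proof -
  have "(\<Sum>j\<in>{..<n} - {i}. msg_bits c (sent (act 0 i) j)) \<le> t + 1" if "i \<in> {..<n} - F" for i
  proof -
    have i: "correct i"
      using that by (simp only: correct_iff)
    have "(\<Sum>j\<in>{..<n} - {i}. msg_bits c (sent (act 0 i) j)) \<le>
        card {j. j < n \<and> j \<in> committee t \<and> odd j \<noteq> v i}"
      by (rule sum_le_card_Collect_less) (use act_0[OF i] in auto)
    also have "\<dots> \<le> card {j. j < 2 * t + 1 \<and> odd j \<noteq> v i}"
      by (rule card_mono) (auto simp: committee_def)
    also have "\<dots> \<le> t + 1"
      using card_parity_less_le[of "2 * t + 1" "v i"] by simp
    finally show ?thesis .
  qed
  then have "round_bits c 0 \<le> card ({..<n} - F) * (t + 1)"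
    unfolding round_bits_def by (metis (no_types, lifting) of_nat_id sum_bounded_above)
  also have "\<dots> \<le> n * (t + 1)"
    using card_correct_le by (rule mult_le_mono1)
  finally show ?thesis .
qed

text \<open>There are at most \<open>2 * t + 1\<close> senders, each writing to recipients of one
  parity, at most half of \<open>n\<close> rounded up.\<close>

lemma round_bits_1: "round_bits c 1 \<le> n * (t + 1)"
proof -
  let ?h = "(n + 1) div 2"
  let ?s = "\<lambda>i. \<Sum>j\<in>{..<n} - {i}. msg_bits c (sent (act 1 i) j)"
  have le: "?s i \<le> ?h" if "i \<in> committee t - F" for i
  proof -
    have i: "correct i" "i \<in> committee t"
      using that committee_bound by (auto simp: correct_def committee_def)
    have "?s i \<le> card {j. j < n \<and> odd j \<noteq> recommended i}"
      by (rule sum_le_card_Collect_less) (use i(2) act_1[OF i(1)] in auto)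
    also have "\<dots> \<le> ?h"
      by (rule card_parity_less_le)
    finally show ?thesis .
  qed
  have "round_bits c 1 = (\<Sum>i\<in>committee t - F. ?s i)"
    unfolding round_bits_def
    by (rule sum.mono_neutral_right)
       (use committee_bound act_1 in \<open>auto simp: committee_def correct_def idle_def\<close>)
  also have "\<dots> \<le> card (committee t - F) * ?h"
    using sum_bounded_above[of "committee t - F" ?s ?h] le by simp
  also have "\<dots> \<le> (2 * t + 1) * ?h"
    using card_mono[of "committee t" "committee t - F"] by (intro mult_le_mono1) auto
  \<comment> \<open>Doubling removes the integer division at the cost of replacing \<open>n\<close>
    by \<open>n + 1\<close>.\<close>
  finally have "2 * round_bits c 1 \<le> (2 * t + 1) * (2 * ?h)"
    by simp
  also have "\<dots> \<le> (2 * t + 1) * (n + 1)"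
    by (rule mult_le_mono2) simp
  \<comment> \<open>Expanded, this is exactly \<open>2 * t + 1 \<le> n\<close>.\<close>
  also have "\<dots> \<le> 2 * (n * (t + 1))"
    using committee_bound by (simp add: algebra_simps)
  finally show ?thesis
    by simp
qed

lemma round_bits_2: "round_bits c 2 \<le> n\<^sup>2"
proof -
  have "(\<Sum>j\<in>{..<n} - {i}. msg_bits c (sent (act 2 i) j)) \<le> n" if "i \<in> {..<n} - F" for i
  proof -
    have i: "correct i"
      using that by (simp only: correct_iff)
    have "(\<Sum>j\<in>{..<n} - {i}. msg_bits c (sent (act 2 i) j)) \<le> card {j. j < n \<and> True}"
      by (rule sum_le_card_Collect_less) (use act_2[OF i] in auto)
    then show ?thesis
      by simp
  qed
  then have "round_bits c 2 \<le> card ({..<n} - F) * n"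
    unfolding round_bits_def by (metis (no_types, lifting) of_nat_id sum_bounded_above)
  also have "\<dots> \<le> n * n"
    using card_correct_le by (rule mult_le_mono1)
  finally show ?thesis
    by (simp add: power2_eq_square)
qed

lemma bits_before_2: "(\<Sum>m<2. round_bits c m) \<le> 2 * n * (t + 1)"
  using round_bits_0[of c] round_bits_1[of c]
  by (simp add: numeral_2_eq_2 distrib_right)

lemma bits_before_3: "bits_before c n F act 3 \<le> 2 * n * (t + 1) + n\<^sup>2"
  using bits_before_2[of c] round_bits_2[of c]
  by (simp add: bits_before_eq numeral_3_eq_3 numeral_2_eq_2)

section \<open>Failure-free runs\<close>

context
  assumes failure_free: "F = {}"
begin

lemma correct_failure_free: "correct i \<longleftrightarrow> i < n"
  unfolding correct_def using failure_free by simp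

text \<open>Without faults every member records the initial values themselves.\<close>

lemma recommended_MAJ: "j \<in> committee t \<Longrightarrow> recommended j = MAJ n v"
  unfolding recommended_def rec_value_def
  by (rule MAJ_cong) (rule committee_value_correct, simp_all only: correct_failure_free)

lemma est_MAJ: "i < n \<Longrightarrow> est i = MAJ n v"
  by (rule est_eqI) (auto simp: recommended_MAJ)

lemma unanimity_failure_free: "i < n \<Longrightarrow> unanimity i"
  unfolding unanimity_def unanimous_def
  by (intro exI[of _ "MAJ n v"])
     (use recommended_MAJ recommendation_correct in \<open>simp add: failure_free\<close>)

lemma decision_2: "i < n \<Longrightarrow> decision (act 2 i) = Some (MAJ n v)"
  by (simp add: act_2 correct_failure_free unanimity_failure_free est_MAJ)

lemma decision_iff: "i < n \<Longrightarrow> decision (act m i) \<noteq> None \<longleftrightarrow> m = 2"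
  using decision_2 decision_cases[of i m] unanimity_failure_free
  by (metis correct_failure_free not_None_eq)

lemma not_helped: "\<not> helped i"
  using act_2 by (auto simp: helped_def received_less correct_failure_free unanimity_failure_free)

lemma sent_late:
  assumes "i < n" "2 \<le> m"
  shows "sent (act m i) = (\<lambda>_. None)"
proof (cases "m = 2")
  case True
  then show ?thesis
    using assms by (simp add: act_2 correct_failure_free unanimity_failure_free)
next
  case False
  then obtain m' where "m = 3 + m'"
    using assms le_Suc_ex[of 3 m] by auto
  then show ?thesis
    using assms act_3[of i m'] by (simp add: correct_failure_free not_helped idle_def)
qed

lemma bits_before_failure_free: "bits_before c n {} act T \<le> 2 * n * (t + 1)"
proof -
  have 0: "round_bits c m = 0" if "2 \<le> m" for m
    using that by (simp add: round_bits_def sent_late)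
  have "bits_before c n {} act T = (\<Sum>m<T. round_bits c m)"
    using bits_before_eq by (simp add: failure_free)
  \<comment> \<open>Taking at least two rounds treats \<open>T < 2\<close> along with the larger
    \<open>T\<close>, whose additional rounds are silent.\<close>
  also have "\<dots> \<le> (\<Sum>m<max T 2. round_bits c m)"
    by (rule sum_mono2) auto
  also have "\<dots> = (\<Sum>m<2. round_bits c m)"
    by (rule sum.mono_neutral_right) (auto simp: 0)
  also have "\<dots> \<le> 2 * n * (t + 1)"
    by (rule bits_before_2)
  finally show ?thesis .
qed

end

end

section \<open>The properties of the composed protocol\<close>

text \<open>The case distinction on help is made per process, since faulty processes can call only
  some of the correct ones into \<open>Base\<close>; the others fall idle.\<close>

theorem theorem2:
  fixes Base :: "(bool, 'm) protocol" and n t k :: nat and c :: "'m \<Rightarrow> nat"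
  assumes "3 \<le> k" and "2 < n" and "1 \<le> t" and "k * t < n"
    and "consensus_protocol n t Base"
  shows "consensus_protocol n t (CC2 n t Base) \<and>
    (\<forall>v act. run n t (CC2 n t Base) {} v act \<longrightarrow>
       (\<forall>i<n. \<forall>m. decision (act m i) \<noteq> None \<longleftrightarrow> m = 2) \<and>
       (\<forall>T. bits_before c n {} act T \<le> 2 * n * (t + 1))) \<and>
    (\<forall>F v act. run n t (CC2 n t Base) F v act \<and> F \<noteq> {} \<longrightarrow>
       bits_before c n F act 3 \<le> 2 * n * (t + 1) + n\<^sup>2 \<and>
       (\<forall>i\<in>{..<n} - F.
          if \<exists>j<n. received n act 2 i j = Some Help
          then reverts_to_base_at n Base act i (estimate t i (state_at n v act i 2)) 3
          else \<forall>m\<ge>3. act m i = idle)) \<and>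
    (\<forall>v act. run n t (CC2 n t Base) {} v act \<longrightarrow>
       (\<forall>i<n. decision (act 2 i) = Some (MAJ n v)))"
proof -
  have "3 * t \<le> k * t"
    using assms(1) by (rule mult_le_mono1)
  then have "2 * t < n"
    using assms(4) by linarith
  then have R: "cc2_run n t Base F v act" if "run n t (CC2 n t Base) F v act" for F v act
    using that by (simp add: cc2_run_def)
  have "consensus_protocol n t (CC2 n t Base)"
    unfolding consensus_protocol_def using R cc2_run.consensus assms(5) by blast
  moreover have "(\<forall>i<n. \<forall>m. decision (act m i) \<noteq> None \<longleftrightarrow> m = 2) \<and>
      (\<forall>T. bits_before c n {} act T \<le> 2 * n * (t + 1)) \<and>
      (\<forall>i<n. decision (act 2 i) = Some (MAJ n v))"
    if "run n t (CC2 n t Base) {} v act" for v act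
    using cc2_run.decision_iff[OF R[OF that] refl]
      cc2_run.bits_before_failure_free[OF R[OF that] refl]
      cc2_run.decision_2[OF R[OF that] refl] by blast
  moreover have "bits_before c n F act 3 \<le> 2 * n * (t + 1) + n\<^sup>2 \<and>
      (\<forall>i\<in>{..<n} - F.
         if \<exists>j<n. received n act 2 i j = Some Help
         then reverts_to_base_at n Base act i (estimate t i (state_at n v act i 2)) 3
         else \<forall>m\<ge>3. act m i = idle)"
    if "run n t (CC2 n t Base) F v act" for F v act
  proof -
    interpret cc2_run n t Base F v act
      by (rule R) (rule that)
    have "act m i = idle" if "correct i" "\<not> helped i" "3 \<le> m" for i m
      using act_3[of i "m - 3"] that by simp
    then show ?thesis
      using bits_before_3 reverts_to_base
      unfolding correct_iff helped_def est_def Ball_def by auto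
  qed
  ultimately show ?thesis
    by blast
qed

end
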